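(* Let $\mathfrak g$, $\mathfrak g^\vee$ be Lie algebras and let $H$, $H^\vee$ be closed 3-forms on $\mathfrak g$, $\mathfrak g^\vee$, respectively. If there exist abelian ideals $\mathfrak a\subset\mathfrak g$, $\mathfrak a^\vee\subset\mathfrak g^\vee$ such that $(\mathfrak g,\mathfrak a,H)$ and $(\mathfrak g^\vee,\mathfrak a^\vee,H^\vee)$ are admissible dual triples, then there exists a linear isomorphism $\varphi:\mathfrak g\oplus\mathfrak g^*\to\mathfrak g^\vee\oplus\mathfrak g^{\vee*}$ preserving the Courant bracket and the canonical bilinear form, i.e. for all $u,v\in\mathfrak g\oplus\mathfrak g^*$, $$\varphi([u,v]_H)=[\varphi(u),\varphi(v)]_{H^\vee},\qquad \langle\varphi(u),\varphi(v)\rangle=\langle u,v\rangle .$$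
   Context: Lie algebras are real and finite-dimensional; $d$ is the Chevalley–Eilenberg differential, with $d\eta(x,y)=-\eta([x,y])$ for $\eta\in\mathfrak g^*$. For a Lie algebra $\mathfrak g$ with a closed 3-form $H\in\Lambda^3\mathfrak g^*$, the Courant bracket on $\mathfrak g\oplus\mathfrak g^*$ is $[X+\xi,Y+\eta]_H=[X,Y]+i_Xd\eta-i_Yd\xi+i_Xi_YH$ (with $(i_Xi_YH)(Z)=H(Y,X,Z)$), and the canonical bilinear form is $\langle X+\xi,Y+\eta\rangle=\frac12(\eta(X)+\xi(Y))$. Admissible triple. $(\mathfrak g,\mathfrak a,H)$ is admissible if $\mathfrak a$ is an abelian ideal of $\mathfrak g$, $H\in\Lambda^3\mathfrak g^*$ is closed, and $H(x,y,\cdot)=0$ for all $x,y\in\mathfrak a$. Dual triples. Let $(\mathfrak g,\mathfrak a,H)$ and $(\mathfrak g^\vee,\mathfrak a^\vee,H^\vee)$ be admissible triples with $\mathfrak g/\mathfrak a\simeq\mathfrak n\simeq\mathfrak g^\vee/\mathfrak a^\vee$, with quotient maps $q:\mathfrak g\to\mathfrak n$, $q^\vee:\mathfrak g^\vee\to\mathfrak n$. Let $\mathfrak c=\{(x,y)\in\mathfrak g\oplus\mathfrak g^\vee: q(x)=q^\vee(y)\}$, a Lie subalgebra of $\mathfrak g\oplus\mathfrak g^\vee$, with projections $p:\mathfrak c\to\mathfrak g$, $p^\vee:\mathfrak c\to\mathfrak g^\vee$, and let $\mathfrak k=\{(x,0):x\in\mathfrak a\}$, $\mathfrak k^\vee=\{(0,y):y\in\mathfrak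 a^\vee\}$. A 2-form $F\in\Lambda^2\mathfrak c^*$ is non-degenerate in the fibers if its restriction $F:\mathfrak k\times\mathfrak k^\vee\to\mathbb R$ is a non-degenerate pairing (in particular $\dim\mathfrak a=\dim\mathfrak a^\vee$). The two triples are dual if $\mathfrak g/\mathfrak a\simeq\mathfrak n\simeq\mathfrak g^\vee/\mathfrak a^\vee$ and there is a 2-form $F\in\Lambda^2\mathfrak c^*$, non-degenerate in the fibers, with $p^*H-p^{\vee*}H^\vee=dF$. *)

theory Defs
  imports "HOL-Analysis.Analysis"
begin

text \<open>
  A real finite-dimensional Lie algebra is a bracket on a type of class \<^class>\<open>real_vector\<close> that is
  spanned by a finite set.  (The class \<open>euclidean_space\<close> is avoided: it would add an inner product
  and exclude dimension 0.)
\<close>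

locale lie_algebra =
  fixes br :: "'a::real_vector \<Rightarrow> 'a \<Rightarrow> 'a"
  assumes fin_dim: "\<exists>B::'a set. finite B \<and> span B = UNIV"
    and bilinear_br: "bilinear br"
    and br_self: "br x x = 0"
    and jacobi: "br x (br y z) + br y (br z x) + br z (br x y) = 0"

definition lie_ideal :: "('a::real_vector \<Rightarrow> 'a \<Rightarrow> 'a) \<Rightarrow> 'a set \<Rightarrow> bool" where
  "lie_ideal br I \<longleftrightarrow> subspace I \<and> (\<forall>x. \<forall>y\<in>I. br x y \<in> I)"

definition abelian_on :: "('a::real_vector \<Rightarrow> 'a \<Rightarrow> 'a) \<Rightarrow> 'a set \<Rightarrow> bool" where
  "abelian_on br I \<longleftrightarrow> (\<forall>x\<in>I. \<forall>y\<in>I. br x y = 0)"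

definition lie_hom ::
    "('a::real_vector \<Rightarrow> 'a \<Rightarrow> 'a) \<Rightarrow> ('b::real_vector \<Rightarrow> 'b \<Rightarrow> 'b) \<Rightarrow> ('a \<Rightarrow> 'b) \<Rightarrow> bool" where
  "lie_hom br br' f \<longleftrightarrow> linear f \<and> (\<forall>x y. f (br x y) = br' (f x) (f y))"

text \<open>
  An identification of the quotient of \<open>br\<close> by \<open>I\<close> with the Lie algebra \<open>brn\<close> is given by its
  quotient map: a surjective Lie algebra homomorphism with kernel \<open>I\<close>.
\<close>

definition quotient_hom ::
    "('a::real_vector \<Rightarrow> 'a \<Rightarrow> 'a) \<Rightarrow> 'a set \<Rightarrow> ('n::real_vector \<Rightarrow> 'n \<Rightarrow> 'n) \<Rightarrow> ('a \<Rightarrow> 'n) \<Rightarrow> bool" where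
  "quotient_hom br I brn q \<longleftrightarrow> lie_hom br brn q \<and> surj q \<and> {x. q x = 0} = I"

definition prod_bracket ::
    "('a \<Rightarrow> 'a \<Rightarrow> 'a) \<Rightarrow> ('b \<Rightarrow> 'b \<Rightarrow> 'b) \<Rightarrow> 'a \<times> 'b \<Rightarrow> 'a \<times> 'b \<Rightarrow> 'a \<times> 'b" where
  "prod_bracket br br' u v = (br (fst u) (fst v), br' (snd u) (snd v))"

text \<open>
  Forms on a subspace \<open>V\<close>; only their values on \<open>V\<close> are meaningful.
\<close>

definition one_form_on :: "'a::real_vector set \<Rightarrow> ('a \<Rightarrow> real) \<Rightarrow> bool" where
  "one_form_on V f \<longleftrightarrow>
     (\<forall>x\<in>V. \<forall>y\<in>V. f (x + y) = f x + f y) \<and> (\<forall>c. \<forall>x\<in>V. f (c *\<^sub>R x) = c * f x)"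

definition two_form_on :: "'a::real_vector set \<Rightarrow> ('a \<Rightarrow> 'a \<Rightarrow> real) \<Rightarrow> bool" where
  "two_form_on V F \<longleftrightarrow>
     (\<forall>x\<in>V. one_form_on V (\<lambda>y. F x y)) \<and>
     (\<forall>y\<in>V. one_form_on V (\<lambda>x. F x y)) \<and>
     (\<forall>x\<in>V. F x x = 0)"

definition three_form_on :: "'a::real_vector set \<Rightarrow> ('a \<Rightarrow> 'a \<Rightarrow> 'a \<Rightarrow> real) \<Rightarrow> bool" where
  "three_form_on V H \<longleftrightarrow>
     (\<forall>x\<in>V. two_form_on V (\<lambda>y z. H x y z)) \<and>
     (\<forall>y\<in>V. two_form_on V (\<lambda>x z. H x y z)) \<and>
     (\<forall>z\<in>V. two_form_on V (\<lambda>x y. H x y z))"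

text \<open>
  The differential of a \<open>k\<close>-form is the sum over \<open>i < j\<close> of \<open>(-1)^(i+j)\<close> times the form evaluated at
  \<open>[x_i, x_j], x_0, ..., x_k\<close> with \<open>x_i\<close> and \<open>x_j\<close> omitted from the list.  It is spelled out here in
  degrees 1, 2 and 3; in degree 1 it is \<open>d f (x, y) = - f [x, y]\<close>.
\<close>

definition d1 :: "('a \<Rightarrow> 'a \<Rightarrow> 'a) \<Rightarrow> ('a \<Rightarrow> real) \<Rightarrow> 'a \<Rightarrow> 'a \<Rightarrow> real" where
  "d1 br f x y = - f (br x y)"

definition d2 :: "('a \<Rightarrow> 'a \<Rightarrow> 'a) \<Rightarrow> ('a \<Rightarrow> 'a \<Rightarrow> real) \<Rightarrow> 'a \<Rightarrow> 'a \<Rightarrow> 'a \<Rightarrow> real" where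
  "d2 br F x y z = - F (br x y) z + F (br x z) y - F (br y z) x"

definition d3 ::
    "('a \<Rightarrow> 'a \<Rightarrow> 'a) \<Rightarrow> ('a \<Rightarrow> 'a \<Rightarrow> 'a \<Rightarrow> real) \<Rightarrow> 'a \<Rightarrow> 'a \<Rightarrow> 'a \<Rightarrow> 'a \<Rightarrow> real" where
  "d3 br H x y z w =
     - H (br x y) z w + H (br x z) y w - H (br x w) y z
     - H (br y z) x w + H (br y w) x z - H (br z w) x y"

definition closed_three_form ::
    "('a::real_vector \<Rightarrow> 'a \<Rightarrow> 'a) \<Rightarrow> ('a \<Rightarrow> 'a \<Rightarrow> 'a \<Rightarrow> real) \<Rightarrow> bool" where
  "closed_three_form br H \<longleftrightarrow> three_form_on UNIV H \<and> (\<forall>x y z w. d3 br H x y z w = 0)"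

definition admissible ::
    "('a::real_vector \<Rightarrow> 'a \<Rightarrow> 'a) \<Rightarrow> 'a set \<Rightarrow> ('a \<Rightarrow> 'a \<Rightarrow> 'a \<Rightarrow> real) \<Rightarrow> bool" where
  "admissible br I H \<longleftrightarrow>
     lie_ideal br I \<and> abelian_on br I \<and> closed_three_form br H \<and>
     (\<forall>x\<in>I. \<forall>y\<in>I. \<forall>z. H x y z = 0)"

definition fiber_product :: "('a \<Rightarrow> 'n) \<Rightarrow> ('b \<Rightarrow> 'n) \<Rightarrow> ('a \<times> 'b) set" where
  "fiber_product q q' = {(x, y). q x = q' y}"

definition nondegenerate_pairing ::
    "'v::real_vector set \<Rightarrow> 'w::real_vector set \<Rightarrow> ('v \<Rightarrow> 'w \<Rightarrow> real) \<Rightarrow> bool" where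
  "nondegenerate_pairing K L F \<longleftrightarrow>
     (\<forall>u\<in>K. (\<forall>v\<in>L. F u v = 0) \<longrightarrow> u = 0) \<and>
     (\<forall>v\<in>L. (\<forall>u\<in>K. F u v = 0) \<longrightarrow> v = 0)"

definition dual_triples ::
    "('n::real_vector \<Rightarrow> 'n \<Rightarrow> 'n) \<Rightarrow>
     ('a::real_vector \<Rightarrow> 'a \<Rightarrow> 'a) \<Rightarrow> 'a set \<Rightarrow> ('a \<Rightarrow> 'a \<Rightarrow> 'a \<Rightarrow> real) \<Rightarrow>
     ('b::real_vector \<Rightarrow> 'b \<Rightarrow> 'b) \<Rightarrow> 'b set \<Rightarrow> ('b \<Rightarrow> 'b \<Rightarrow> 'b \<Rightarrow> real) \<Rightarrow> bool" where
  "dual_triples brn br I H br' I' H' \<longleftrightarrow>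
     (\<exists>q q' F.
        quotient_hom br I brn q \<and> quotient_hom br' I' brn q' \<and>
        two_form_on (fiber_product q q') F \<and>
        nondegenerate_pairing (I \<times> {0}) ({0} \<times> I') F \<and>
        (\<forall>u\<in>fiber_product q q'. \<forall>v\<in>fiber_product q q'. \<forall>w\<in>fiber_product q q'.
           H (fst u) (fst v) (fst w) - H' (snd u) (snd v) (snd w)
             = d2 (prod_bracket br br') F u v w))"

typedef (overloaded) 'a dual = "{f :: 'a::real_vector \<Rightarrow> real. linear f}"
  morphisms dual_apply Dual
  by (rule exI[of _ "\<lambda>_. 0"]) (simp add: linear_zero)

setup_lifting type_definition_dual

instantiation dual :: (real_vector) real_vector
begin

lift_definition zero_dual :: "'a dual" is "\<lambda>_. 0"
  by (rule linear_zero)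

lift_definition plus_dual :: "'a dual \<Rightarrow> 'a dual \<Rightarrow> 'a dual" is "\<lambda>f g x. f x + g x"
  by (rule linear_compose_add)

lift_definition minus_dual :: "'a dual \<Rightarrow> 'a dual \<Rightarrow> 'a dual" is "\<lambda>f g x. f x - g x"
  by (rule linear_compose_sub)

lift_definition uminus_dual :: "'a dual \<Rightarrow> 'a dual" is "\<lambda>f x. - f x"
  by (rule linear_compose_neg)

lift_definition scaleR_dual :: "real \<Rightarrow> 'a dual \<Rightarrow> 'a dual" is "\<lambda>c f x. c *\<^sub>R f x"
  by (rule linear_compose_scale_right)

instance
  by standard (transfer; simp add: algebra_simps fun_eq_iff)+

end

definition dual_pairing :: "'a::real_vector \<times> 'a dual \<Rightarrow> 'a \<times> 'a dual \<Rightarrow> real" where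
  "dual_pairing u v = (dual_apply (snd v) (fst u) + dual_apply (snd u) (fst v)) / 2"

text \<open>
  Iterated contraction reverses the arguments: \<open>(i_X i_Y H)(Z) = H(Y, X, Z)\<close>.
  The covector part of the Courant bracket is built with \<^const>\<open>Dual\<close>, which is meaningful only on
  linear arguments; \<open>dual_apply_courant_bracket\<close> below shows that this is the case whenever \<open>br\<close> is a
  Lie bracket and \<open>H\<close> a 3-form.
\<close>

definition courant_bracket ::
    "('a::real_vector \<Rightarrow> 'a \<Rightarrow> 'a) \<Rightarrow> ('a \<Rightarrow> 'a \<Rightarrow> 'a \<Rightarrow> real) \<Rightarrow>
     'a \<times> 'a dual \<Rightarrow> 'a \<times> 'a dual \<Rightarrow> 'a \<times> 'a dual" where
  "courant_bracket br H u v =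
     (case (u, v) of ((X, \<xi>), (Y, \<eta>)) \<Rightarrow>
        (br X Y,
         Dual (\<lambda>Z. d1 br (dual_apply \<eta>) X Z - d1 br (dual_apply \<xi>) Y Z + H Y X Z)))"

lemma dual_apply_courant_bracket:
  assumes "lie_algebra br" and "three_form_on UNIV H"
  shows "dual_apply (snd (courant_bracket br H (X, \<xi>) (Y, \<eta>))) Z =
     d1 br (dual_apply \<eta>) X Z - d1 br (dual_apply \<xi>) Y Z + H Y X Z"
proof -
  interpret lie_algebra br by fact
  have br: "linear (br W)" for W
    using bilinear_br by (simp add: bilinear_def)
  have app: "linear (\<lambda>Z. dual_apply \<zeta> (br W Z))" for \<zeta> W
    using linear_compose[OF br, of "dual_apply \<zeta>"] dual_apply[of \<zeta>] by (simp add: o_def)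
  have H: "linear (H Y X)"
    using assms(2)
    by (intro linearI) (simp_all add: three_form_on_def two_form_on_def one_form_on_def)
  have "linear (\<lambda>Z. d1 br (dual_apply \<eta>) X Z - d1 br (dual_apply \<xi>) Y Z + H Y X Z)"
    unfolding d1_def
    by (intro linear_compose_add linear_compose_sub linear_compose_neg app H)
  then show ?thesis
    by (simp add: courant_bracket_def Dual_inverse)
qed

end

theory Submission
  imports Defs
begin

text \<open>
  Relate \<open>X + \<xi>\<close> to \<open>Y + \<eta>\<close> when \<open>u = (X, Y)\<close> lies in the fiber product and
  \<open>p\<^sup>*\<xi> - i\<^sub>u F\<close> equals \<open>p'\<^sup>*\<eta>\<close>.  Skew-symmetry of \<open>F\<close> makes the relation
  compatible with the pairings, and \<open>dF = p\<^sup>*H - p'\<^sup>*H'\<close> makes it compatible with the Courant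
  brackets.  Restricted to the kernel of \<open>q\<close>, the condition reads \<open>\<xi> = F (u, \<cdot>)\<close>; since \<open>F\<close> is
  non-degenerate in the fibers, it determines \<open>Y\<close> from \<open>X + \<xi>\<close>, and then \<open>\<eta>\<close> is determined by
  descent.  As the situation is symmetric, the relation is the graph of a bijection.
\<close>

section \<open>Linear functionals, one-forms on subspaces, and pairings of subspaces\<close>

lemma linear_dual_apply: "linear (dual_apply f)"
  using dual_apply[of f] by simp

lemmas dual_apply_linear_simps =
  linear_add[OF linear_dual_apply] linear_scale[OF linear_dual_apply]
  linear_0[OF linear_dual_apply] linear_diff[OF linear_dual_apply]

lemma one_form_on_sum:
  assumes f: "one_form_on V f" and V: "subspace V"
    and "finite B" and "\<And>b. b \<in> B \<Longrightarrow> g b \<in> V"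
  shows "f (\<Sum>b\<in>B. c b *\<^sub>R g b) = (\<Sum>b\<in>B. c b * f (g b))"
  using assms(3,4)
proof (induction rule: finite_induct)
  case empty
  have "f (0 *\<^sub>R 0) = 0 * f 0"
    using f V subspace_0 unfolding one_form_on_def by blast
  then show ?case
    by simp
next
  case (insert b B)
  then have "(\<Sum>b\<in>B. c b *\<^sub>R g b) \<in> V" "c b *\<^sub>R g b \<in> V" "g b \<in> V"
    using V by (auto intro!: subspace_sum subspace_scale)
  then show ?case
    using f insert by (simp add: one_form_on_def)
qed

lemma one_form_on_add_scale:
  assumes "one_form_on V f" "subspace V" "x \<in> V" "y \<in> V"
  shows "f (x + c *\<^sub>R y) = f x + c * f y"
  using assms subspace_scale[of V y c] by (simp add: one_form_on_def)

text \<open>Since \<open>P\<close> has no left kernel, the functionals \<open>P b\<close> on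
  \<open>L\<close> stay linearly independent as \<open>b\<close> runs over an independent set, so
  their values can be prescribed. The induction adds one functional at a time.\<close>

lemma pairing_interpolation:
  fixes P :: "'v::real_vector \<Rightarrow> 'w::real_vector \<Rightarrow> real"
  assumes K: "subspace K" and L: "subspace L"
    and P1: "\<And>y. y \<in> L \<Longrightarrow> one_form_on K (\<lambda>x. P x y)"
    and P2: "\<And>x. x \<in> K \<Longrightarrow> one_form_on L (P x)"
    and nd: "\<And>x. x \<in> K \<Longrightarrow> (\<And>y. y \<in> L \<Longrightarrow> P x y = 0) \<Longrightarrow> x = 0"
    and B: "finite B" "independent B" "B \<subseteq> K"
  shows "\<exists>y\<in>L. \<forall>b\<in>B. P b y = f b"
  using B
proof (induction arbitrary: f rule: finite_induct)
  case empty
  then show ?case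
    using subspace_0[OF L] by blast
next
  case (insert b B)
  then have b: "b \<in> K" "b \<notin> span B" and BK: "B \<subseteq> K"
    by (auto simp: independent_insert)
  have IH: "\<exists>y\<in>L. \<forall>b\<in>B. P b y = f b" for f
    using insert by (simp add: independent_insert)
  \<comment> \<open>The induction hypothesis for indicator functions supplies a family
    \<open>e\<close> in \<open>L\<close> dual to \<open>B\<close> under \<open>P\<close>.\<close>
  have "\<forall>b'. \<exists>y\<in>L. \<forall>b''\<in>B. P b'' y = (if b'' = b' then 1 else 0)"
    by (intro allI) (rule IH)
  then obtain e where e: "\<And>b'. e b' \<in> L" "\<And>b' b''. b'' \<in> B \<Longrightarrow> P b'' (e b') = (if b'' = b' then 1 else 0)"
    by metis
  have P_diff: "P x (y - z) = P x y - P x z" if "x \<in> K" "y \<in> L" "z \<in> L" for x y z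
  proof -
    have "P x (y + (-1) *\<^sub>R z) = P x y + (-1) * P x z"
      using one_form_on_add_scale[OF P2 L] that by blast
    then show ?thesis by simp
  qed
  have P_sum: "P x (\<Sum>b\<in>B. c b *\<^sub>R e b) = (\<Sum>b\<in>B. c b * P x (e b))" if "x \<in> K" for c x
    using one_form_on_sum[OF P2[OF that] L \<open>finite B\<close>] e by simp
  have sum_L: "(\<Sum>b\<in>B. c b *\<^sub>R e b) \<in> L" for c
    using L e by (simp add: subspace_sum subspace_scale)
  have P_sum_B: "P b' (\<Sum>b\<in>B. c b *\<^sub>R e b) = c b'" if "b' \<in> B" for c b'
  proof -
    have "P b' (\<Sum>b\<in>B. c b *\<^sub>R e b) = (\<Sum>b\<in>B. c b * (if b' = b then 1 else 0))"
      using that BK by (auto simp: P_sum e)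
    then show ?thesis
      using that \<open>finite B\<close> by (simp add: if_distrib cong: if_cong)
  qed
  \<comment> \<open>Otherwise \<open>b - (\<Sum>b'\<in>B. P b (e b') *\<^sub>R b')\<close> would lie in the left kernel of \<open>P\<close>.\<close>
  obtain z where z: "z \<in> L" "\<And>b'. b' \<in> B \<Longrightarrow> P b' z = 0" "P b z \<noteq> 0"
  proof (rule ccontr)
    assume "\<not> thesis"
    then have no: "P b z = 0" if "z \<in> L" "\<And>b'. b' \<in> B \<Longrightarrow> P b' z = 0" for z
      using that \<open>\<And>z. \<lbrakk>z \<in> L; \<And>b'. b' \<in> B \<Longrightarrow> P b' z = 0; P b z \<noteq> 0\<rbrakk> \<Longrightarrow> thesis\<close> by blast
    let ?s = "\<Sum>b'\<in>B. P b (e b') *\<^sub>R b'"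
    have s: "?s \<in> span B"
      by (simp add: span_base span_scale span_sum)
    have sK: "?s \<in> K"
      using s BK K by (meson span_minimal subsetD)
    have "P (b - ?s) y = 0" if y: "y \<in> L" for y
    proof -
      \<comment> \<open>Removing the \<open>e\<close>-components of \<open>y\<close> leaves a vector
        annihilated by every element of \<open>B\<close>, hence by \<open>b\<close> as well. So on
        \<open>L\<close> the functional \<open>P b\<close> is the combination of the
        \<open>P b'\<close> with coefficients \<open>P b (e b')\<close>.\<close>
      have "P b (y - (\<Sum>b'\<in>B. P b' y *\<^sub>R e b')) = 0"
        using y sum_L BK by (intro no) (auto simp: P_diff P_sum_B subspace_diff[OF L])
      then have "P b y = (\<Sum>b'\<in>B. P b' y * P b (e b'))"
        using y sum_L b by (simp add: P_diff P_sum)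
      moreover have "P ?s y = (\<Sum>b'\<in>B. P b (e b') * P b' y)"
        using BK by (intro one_form_on_sum[OF P1[OF y] K \<open>finite B\<close>]) auto
      moreover have "P (b + (-1) *\<^sub>R ?s) y = P b y + (-1) * P ?s y"
        by (rule one_form_on_add_scale[OF P1[OF y] K b(1) sK])
      ultimately show ?thesis
        by (simp add: mult.commute)
    qed
    then have "b - ?s = 0"
      using b sK K by (intro nd) (auto intro: subspace_diff)
    then show False
      using s b by simp
  qed
  obtain y where y: "y \<in> L" "\<And>b'. b' \<in> B \<Longrightarrow> P b' y = f b'"
    using IH by blast
  \<comment> \<open>Adding a multiple of \<open>z\<close> leaves the values on \<open>B\<close>
    alone, and \<open>?t\<close> is the multiple that corrects the value at
    \<open>b\<close>.\<close>
  let ?t = "(f b - P b y) / P b z"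
  have *: "P x (y + ?t *\<^sub>R z) = P x y + ?t * P x z" if "x \<in> K" for x
    by (rule one_form_on_add_scale[OF P2[OF that] L y(1) z(1)])
  have "P b (y + ?t *\<^sub>R z) = f b"
    using *[OF b(1)] z(3) by simp
  moreover have "P b' (y + ?t *\<^sub>R z) = f b'" if "b' \<in> B" for b'
    using *[of b'] y(2)[OF that] z(2)[OF that] that BK by auto
  moreover have "y + ?t *\<^sub>R z \<in> L"
    using y(1) z(1) L by (simp add: subspace_add subspace_scale)
  ultimately show ?case
    by blast
qed

text \<open>Interpolation on a basis of \<open>K\<close>, which is finite because the ambient space
  is finite-dimensional, extends to \<open>K\<close> by linearity. This is what later supplies the
  component of \<open>Y\<close> along the fiber.\<close>

lemma pairing_represents:
  fixes P :: "'v::real_vector \<Rightarrow> 'w::real_vector \<Rightarrow> real"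
  assumes fin: "\<exists>S::'v set. finite S \<and> span S = UNIV"
    and K: "subspace K" and L: "subspace L"
    and P1: "\<And>y. y \<in> L \<Longrightarrow> one_form_on K (\<lambda>x. P x y)"
    and P2: "\<And>x. x \<in> K \<Longrightarrow> one_form_on L (P x)"
    and nd: "\<And>x. x \<in> K \<Longrightarrow> (\<And>y. y \<in> L \<Longrightarrow> P x y = 0) \<Longrightarrow> x = 0"
    and f: "one_form_on K f"
  shows "\<exists>y\<in>L. \<forall>x\<in>K. P x y = f x"
proof -
  obtain B where B: "B \<subseteq> K" "independent B" "K \<subseteq> span B"
    using basis_exists[of K] by metis
  have "finite B"
    using fin independent_span_bound[OF _ B(2)] by auto
  obtain y where y: "y \<in> L" "\<And>b. b \<in> B \<Longrightarrow> P b y = f b"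
    using pairing_interpolation[OF K L P1 P2 nd \<open>finite B\<close> B(2,1), of f] by blast
  have "P x y = f x" if "x \<in> K" for x
  proof -
    obtain c where "x = (\<Sum>b\<in>B. c b *\<^sub>R b)"
      using \<open>x \<in> K\<close> B(3) span_finite[OF \<open>finite B\<close>] by blast
    moreover have "P (\<Sum>b\<in>B. c b *\<^sub>R b) y = (\<Sum>b\<in>B. c b * P b y)"
      using B(1) by (intro one_form_on_sum[OF P1[OF y(1)] K \<open>finite B\<close>]) auto
    moreover have "f (\<Sum>b\<in>B. c b *\<^sub>R b) = (\<Sum>b\<in>B. c b * f b)"
      using B(1) by (intro one_form_on_sum[OF f K \<open>finite B\<close>]) auto
    ultimately show ?thesis
      by (simp add: y(2))
  qed
  then show ?thesis
    using y by blast
qed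

text \<open>Brackets and 3-forms are kept out, so that these assumptions are stable under exchanging
  the two sides; the locale is interpreted a second time with the roles swapped to obtain
  bijectivity.\<close>

locale fiberwise_nondegenerate =
  fixes q :: "'g::real_vector \<Rightarrow> 'n::real_vector" and q' :: "'h::real_vector \<Rightarrow> 'n"
    and F :: "'g \<times> 'h \<Rightarrow> 'g \<times> 'h \<Rightarrow> real"
  assumes fin: "\<exists>S::'g set. finite S \<and> span S = UNIV"
    and fin': "\<exists>S::'h set. finite S \<and> span S = UNIV"
    and q: "linear q" "surj q" and q': "linear q'" "surj q'"
    and F: "two_form_on (fiber_product q q') F"
    and nondegenerate: "nondegenerate_pairing ({x. q x = 0} \<times> {0}) ({0} \<times> {y. q' y = 0}) F"
begin

abbreviation C where "C \<equiv> fiber_product q q'"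

lemma C_iff: "(x, y) \<in> C \<longleftrightarrow> q x = q' y"
  by (simp add: fiber_product_def)

lemma subspace_C: "subspace C"
  by (auto simp: subspace_def fiber_product_def linear_0 q q' linear_add linear_scale
      zero_prod_def)

lemma F_add_left: "u \<in> C \<Longrightarrow> v \<in> C \<Longrightarrow> w \<in> C \<Longrightarrow> F (u + v) w = F u w + F v w"
  and F_add_right: "u \<in> C \<Longrightarrow> v \<in> C \<Longrightarrow> w \<in> C \<Longrightarrow> F w (u + v) = F w u + F w v"
  and F_scale_left: "u \<in> C \<Longrightarrow> w \<in> C \<Longrightarrow> F (c *\<^sub>R u) w = c * F u w"
  and F_scale_right: "u \<in> C \<Longrightarrow> w \<in> C \<Longrightarrow> F w (c *\<^sub>R u) = c * F w u"
  and F_self: "u \<in> C \<Longrightarrow> F u u = 0"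
  using F by (simp_all add: two_form_on_def one_form_on_def)

lemma F_skew: "u \<in> C \<Longrightarrow> v \<in> C \<Longrightarrow> F u v = - F v u"
  using F_self[of "u + v"] F_self[of u] F_self[of v] subspace_add[OF subspace_C, of u v]
  by (simp add: F_add_left F_add_right)

section \<open>The linear relation defined by the two-form\<close>

definition related :: "'g \<times> 'g dual \<Rightarrow> 'h \<times> 'h dual \<Rightarrow> bool" where
  "related u v \<longleftrightarrow> (fst u, fst v) \<in> C \<and>
     (\<forall>w\<in>C. dual_apply (snd u) (fst w) - F (fst u, fst v) w = dual_apply (snd v) (snd w))"

lemma related_add:
  assumes "related u v" and "related u' v'"
  shows "related (u + u') (v + v')"
proof -
  have C: "(fst u, fst v) \<in> C" "(fst u', fst v') \<in> C"
    using assms by (simp_all add: related_def)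
  have eq: "dual_apply (snd u) (fst w) = F (fst u, fst v) w + dual_apply (snd v) (snd w)"
    "dual_apply (snd u') (fst w) = F (fst u', fst v') w + dual_apply (snd v') (snd w)"
    if "w \<in> C" for w
    using assms that by (fastforce simp: related_def)+
  show ?thesis
    using subspace_add[OF subspace_C C] F_add_left[OF C]
    by (simp add: related_def plus_dual.rep_eq eq)
qed

lemma related_scale:
  assumes "related u v"
  shows "related (c *\<^sub>R u) (c *\<^sub>R v)"
  using assms subspace_scale[OF subspace_C, of "(fst u, fst v)" c]
    F_scale_left[of "(fst u, fst v)" _ c]
  by (auto simp: related_def scaleR_dual.rep_eq simp flip: right_diff_distrib)

lemma dual_eqI: "(\<And>x. dual_apply f x = dual_apply g x) \<Longrightarrow> f = g"
  by (metis dual_apply_inject ext)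

text \<open>Testing the relation on \<open>(x, 0)\<close> with \<open>q x = 0\<close> leaves only
  \<open>F (0, ?y) (x, 0) = 0\<close>, so non-degeneracy kills the vector part. The covector then
  vanishes because \<open>C\<close> projects onto the second factor, \<open>q\<close> being
  surjective.\<close>

lemma related_zero_left:
  assumes "related 0 v"
  shows "v = 0"
proof -
  let ?y = "fst v"
  have y: "q' ?y = 0"
    using assms by (simp add: related_def C_iff linear_0 q)
  have "F (x, 0) (0, ?y) = 0" if x: "q x = 0" for x
  proof -
    have "(x, 0) \<in> C" "(0, ?y) \<in> C"
      using x y by (simp_all add: C_iff linear_0 q q')
    then show ?thesis
      using assms F_skew[of "(x, 0)" "(0, ?y)"]
      by (force simp: related_def zero_dual.rep_eq dual_apply_linear_simps)
  qed
  then have "(0::'g, ?y) = 0"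
    using nondegenerate y unfolding nondegenerate_pairing_def by blast
  then have y0: "?y = 0"
    by (simp add: zero_prod_def)
  have "dual_apply (snd v) z = dual_apply 0 z" for z
  proof -
    obtain x where "q x = q' z"
      using q(2) by (metis surjD)
    then have w: "(x, z) \<in> C"
      by (simp add: C_iff)
    have "F (0, 0) (x, z) = 0"
      using F_scale_left[OF w w, of 0] by (simp add: zero_prod_def)
    then show ?thesis
      using assms w y0 by (force simp: related_def zero_dual.rep_eq)
  qed
  then show ?thesis
    using y0 by (simp add: prod_eq_iff dual_eqI)
qed

text \<open>The relation is closed under linear combinations, so the difference of two partners of
  \<open>u\<close> is related to \<open>0\<close>.\<close>

lemma related_right_unique:
  assumes "related u v" and "related u v'"
  shows "v = v'"
  using related_zero_left[of "v - v'"] related_add[OF assms(1) related_scale[OF assms(2), of "-1"]]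
  by simp

text \<open>A lift \<open>y0\<close> of \<open>q x\<close> is corrected by a fiber vector
  \<open>l\<close> until the one-form on \<open>C\<close> vanishes on the kernel of the projection
  to the second factor; the form then descends along this projection.\<close>

lemma related_left_total: "\<exists>v. related u v"
proof -
  obtain x \<xi> where u: "u = (x, \<xi>)"
    by fastforce
  obtain y0 where "q x = q' y0"
    using q'(2) by (metis surjD)
  then have c0: "(x, y0) \<in> C"
    by (simp add: C_iff)
  let ?K = "{x. q x = 0}" and ?L = "{y. q' y = 0}"
  have K: "subspace ?K" and L: "subspace ?L"
    by (simp_all add: linear_subspace_kernel q q')
  have KC: "(k, 0) \<in> C" if "k \<in> ?K" for k
    using that by (simp add: C_iff linear_0 q')
  have LC: "(0, l) \<in> C" if "l \<in> ?L" for l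
    using that by (simp add: C_iff linear_0 q)
  have fK: "one_form_on ?K (\<lambda>k. F v (k, 0))" if "v \<in> C" for v
    unfolding one_form_on_def
    using that F_add_right[OF KC KC, of _ _ v] F_scale_right[OF KC, of _ v] by simp
  \<comment> \<open>Replacing \<open>y0\<close> by \<open>y0 + l\<close> changes the contraction at
    \<open>(k, 0)\<close> by \<open>F (0, l) (k, 0)\<close>, so this equation asks \<open>l\<close>
    to make up exactly the defect of \<open>y0\<close>.\<close>
  have "\<exists>l\<in>?L. \<forall>k\<in>?K. F (0, l) (k, 0) = dual_apply \<xi> k - F (x, y0) (k, 0)"
  proof (rule pairing_represents[OF fin K L])
    show "one_form_on ?K (\<lambda>k. F (0, l) (k, 0))" if "l \<in> ?L" for l
      using fK LC that by blast
    show "one_form_on ?L (\<lambda>l. F (0, l) (k, 0))" if "k \<in> ?K" for k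
      unfolding one_form_on_def
      using F_add_left[OF LC LC KC[OF that]] F_scale_left[OF LC KC[OF that]] by simp
    show "k = 0" if k: "k \<in> ?K" and "\<And>l. l \<in> ?L \<Longrightarrow> F (0, l) (k, 0) = 0" for k
    proof -
      have "F (k, 0) (0, l) = 0" if "l \<in> ?L" for l
        using F_skew[OF KC[OF k] LC[OF that]] that \<open>\<And>l. l \<in> ?L \<Longrightarrow> F (0, l) (k, 0) = 0\<close> by simp
      then have "(k, 0::'h) = 0"
        using nondegenerate k unfolding nondegenerate_pairing_def by blast
      then show ?thesis
        by (simp add: zero_prod_def)
    qed
    show "one_form_on ?K (\<lambda>k. dual_apply \<xi> k - F (x, y0) (k, 0))"
      using fK[OF c0] by (simp add: one_form_on_def dual_apply_linear_simps algebra_simps)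
  qed
  then obtain l where l: "l \<in> ?L"
    and Fl: "\<And>k. k \<in> ?K \<Longrightarrow> F (0, l) (k, 0) = dual_apply \<xi> k - F (x, y0) (k, 0)"
    by blast
  define c where "c = (x, y0 + l)"
  have c: "c \<in> C"
    using c0 l by (simp add: c_def C_iff linear_add q')
  have Fc: "F c (k, 0) = dual_apply \<xi> k" if "k \<in> ?K" for k
    using Fl[OF that] F_add_left[OF c0 LC[OF l] KC[OF that]] by (simp add: c_def)
  \<comment> \<open>A linear right inverse of \<open>q\<close> yields the linear section
    \<open>y \<mapsto> (s y, y)\<close> of the projection of \<open>C\<close> to the second factor;
    pulling the one-form back along it defines the descended covector \<open>h\<close>.\<close>
  obtain r where r: "linear r" "q \<circ> r = id"
    using linear_surj_right_inverse[of q UNIV UNIV] q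
    by (auto simp: fun_eq_iff)
  define s where "s = r \<circ> q'"
  have s: "linear s" "(s y, y) \<in> C" for y
    using r q' by (auto simp: s_def C_iff linear_compose fun_eq_iff)
  define h where "h y = dual_apply \<xi> (s y) - F c (s y, y)" for y
  have "linear h"
    using F_add_right[OF s(2) s(2) c] F_scale_right[OF s(2) c]
    by (intro linearI) (simp_all add: h_def s(1) linear_add linear_scale
        dual_apply_linear_simps algebra_simps)
  then have h: "dual_apply (Dual h) = h"
    by (simp add: Dual_inverse)
  \<comment> \<open>The points \<open>(a, b)\<close> and \<open>(s b, b)\<close> differ by
    \<open>(a - s b, 0)\<close>, where the one-form vanishes by the choice of
    \<open>l\<close>.\<close>
  have "dual_apply \<xi> a - F c (a, b) = h b" if "(a, b) \<in> C" for a b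
  proof -
    have k: "a - s b \<in> ?K"
      using that s(2)[of b] by (simp add: C_iff linear_diff q)
    have "F c (a, b) = F c (a - s b, 0) + F c (s b, b)"
      using F_add_right[OF KC[OF k] s(2) c, of b] by simp
    then show ?thesis
      using Fc[OF k] by (simp add: h_def dual_apply_linear_simps)
  qed
  then have "related u (y0 + l, Dual h)"
    using c by (auto simp: related_def u h simp flip: c_def)
  then show ?thesis ..
qed

text \<open>Each relation is evaluated at the vector part of the other pair; in the sum the two
  \<open>F\<close> terms cancel by skew-symmetry.\<close>

lemma related_pairing:
  assumes "related u v" and "related u' v'"
  shows "dual_pairing v v' = dual_pairing u u'"
  using assms F_skew[of "(fst u, fst v)" "(fst u', fst v')"]
  by (force simp: related_def dual_pairing_def)

text \<open>The vector parts match because \<open>C\<close> is closed under the product bracket. For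
  the covectors, \<open>dF\<close> has three terms: two are converted into covector terms by the
  given relations, and the third is the contraction with the bracket of the vector parts.\<close>

lemma related_courant:
  assumes "lie_algebra br" and "lie_algebra br'"
    and "three_form_on UNIV H" and "three_form_on UNIV H'"
    and hom: "\<And>x y. q (br x y) = brn (q x) (q y)" "\<And>x y. q' (br' x y) = brn (q' x) (q' y)"
    and dF: "\<And>u v w. u \<in> C \<Longrightarrow> v \<in> C \<Longrightarrow> w \<in> C \<Longrightarrow>
        H (fst u) (fst v) (fst w) - H' (snd u) (snd v) (snd w)
          = d2 (prod_bracket br br') F u v w"
    and rel: "related u1 v1" "related u2 v2"
  shows "related (courant_bracket br H u1 u2) (courant_bracket br' H' v1 v2)"
proof -
  obtain x1 \<xi>1 x2 \<xi>2 y1 \<eta>1 y2 \<eta>2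
    where e: "u1 = (x1, \<xi>1)" "u2 = (x2, \<xi>2)" "v1 = (y1, \<eta>1)" "v2 = (y2, \<eta>2)"
    by (metis surj_pair)
  let ?b = "prod_bracket br br'"
  have bC: "?b c c' \<in> C" if "c \<in> C" "c' \<in> C" for c c'
    using that by (auto simp: fiber_product_def prod_bracket_def hom)
  define c1 c2 where "c1 = (x1, y1)" and "c2 = (x2, y2)"
  have c: "c1 \<in> C" "c2 \<in> C"
    using rel by (auto simp: related_def e c1_def c2_def)
  have r1: "dual_apply \<xi>1 (fst w) - F c1 w = dual_apply \<eta>1 (snd w)"
    and r2: "dual_apply \<xi>2 (fst w) - F c2 w = dual_apply \<eta>2 (snd w)" if "w \<in> C" for w
    using rel that by (auto simp: related_def e c1_def c2_def)
  interpret g: lie_algebra br by fact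
  interpret h: lie_algebra br' by fact
  have skew: "br x2 x1 = - br x1 x2" "br' y2 y1 = - br' y1 y2"
    using g.br_self[of "x1 + x2"] g.br_self[of x1] g.br_self[of x2]
      h.br_self[of "y1 + y2"] h.br_self[of y1] h.br_self[of y2]
    by (simp_all add: g.bilinear_br h.bilinear_br bilinear_ladd bilinear_radd
        eq_neg_iff_add_eq_0 add.commute)
  show ?thesis
    unfolding related_def
  proof (intro conjI ballI)
    show "(fst (courant_bracket br H u1 u2), fst (courant_bracket br' H' v1 v2)) \<in> C"
      using bC[OF c] by (simp add: courant_bracket_def e c1_def c2_def prod_bracket_def)
    fix w assume w: "w \<in> C"
    have "?b c2 c1 = (-1) *\<^sub>R ?b c1 c2"
      using skew by (simp add: prod_bracket_def c1_def c2_def)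
    then have "F (?b c2 c1) w = - F (?b c1 c2) w"
      using F_scale_left[OF bC[OF c] w, of "-1"] by simp
    \<comment> \<open>The order \<open>c2\<close>, \<open>c1\<close> follows the reversed arguments
      of the 3-form in the Courant bracket; the sign change just proved turns the first term into
      \<open>F (?b c1 c2) w\<close>.\<close>
    moreover have "H x2 x1 (fst w) - H' y2 y1 (snd w)
        = - F (?b c2 c1) w + F (?b c2 w) c1 - F (?b c1 w) c2"
      using dF[OF c(2,1) w] by (simp add: d2_def c1_def c2_def)
    moreover have "F (?b c2 w) c1 = - F c1 (?b c2 w)" "F (?b c1 w) c2 = - F c2 (?b c1 w)"
      using F_skew c w bC by blast+
    \<comment> \<open>The relations at \<open>?b c2 w\<close> and \<open>?b c1 w\<close> trade the
      other two \<open>F\<close> terms for the \<open>d1\<close> terms of the two Courant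
      brackets.\<close>
    moreover note r1[OF bC[OF c(2) w]] r2[OF bC[OF c(1) w]]
    ultimately have "- dual_apply \<xi>2 (br x1 (fst w)) + dual_apply \<xi>1 (br x2 (fst w))
        + H x2 x1 (fst w) - F (?b c1 c2) w
      = - dual_apply \<eta>2 (br' y1 (snd w)) + dual_apply \<eta>1 (br' y2 (snd w)) + H' y2 y1 (snd w)"
      by (simp add: prod_bracket_def c1_def c2_def)
    then show "dual_apply (snd (courant_bracket br H u1 u2)) (fst w)
        - F (fst (courant_bracket br H u1 u2), fst (courant_bracket br' H' v1 v2)) w
      = dual_apply (snd (courant_bracket br' H' v1 v2)) (snd w)"
      using assms(1-4)
      by (simp add: e dual_apply_courant_bracket d1_def)
        (simp add: courant_bracket_def prod_bracket_def c1_def c2_def)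
  qed
qed

text \<open>The converse relation is of the same kind with the two sides exchanged, so totality and
  uniqueness carry over to it.\<close>

lemma related_ex1_left: "\<exists>!u. related u v"
proof -
  \<comment> \<open>The sign comes from moving the \<open>F\<close> term to the other side:
    \<open>\<xi> - F = \<eta>\<close> becomes \<open>\<eta> - (- F) = \<xi>\<close>.\<close>
  let ?G = "\<lambda>c c'. - F (prod.swap c) (prod.swap c')"
  have sw: "prod.swap c \<in> C \<longleftrightarrow> c \<in> fiber_product q' q" for c
    by (auto simp: fiber_product_def)
  have F_flip: "F (0, y) (x, 0) = - F (x, 0) (0, y)" if "q x = 0" "q' y = 0" for x y
    using that by (intro F_skew) (simp_all add: C_iff linear_0 q q')
  have swap: "prod.swap (c + d) = prod.swap c + prod.swap d"
    "prod.swap (t *\<^sub>R c) = t *\<^sub>R prod.swap c" for c d :: "'h \<times> 'g" and t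
    by (simp_all add: prod_eq_iff)
  interpret flip: fiberwise_nondegenerate q' q ?G
  proof (rule fiberwise_nondegenerate.intro)
    show "two_form_on (fiber_product q' q) ?G"
      by (simp add: two_form_on_def one_form_on_def swap F_add_left F_add_right
          F_scale_left F_scale_right F_self flip: sw)
    show "nondegenerate_pairing ({y. q' y = 0} \<times> {0}) ({0} \<times> {x. q x = 0}) ?G"
      unfolding nondegenerate_pairing_def
    proof safe
      fix y :: 'h assume "q' y = 0" "\<forall>v\<in>{0} \<times> {x. q x = 0}. ?G (y, 0) v = 0"
      then have "F (x, 0) (0, y) = 0" if "q x = 0" for x
        using that F_flip[of x y] by auto
      then have "(0::'g, y) = 0"
        using nondegenerate \<open>q' y = 0\<close> unfolding nondegenerate_pairing_def by blast
      then show "(y, 0::'g) = 0"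
        by (simp add: zero_prod_def)
    next
      fix x :: 'g assume "q x = 0" "\<forall>u\<in>{y. q' y = 0} \<times> {0}. ?G u (0, x) = 0"
      then have "F (x, 0) (0, y) = 0" if "q' y = 0" for y
        using that F_flip[of x y] by auto
      then have "(x, 0::'h) = 0"
        using nondegenerate \<open>q x = 0\<close> unfolding nondegenerate_pairing_def by blast
      then show "(0::'h, x) = 0"
        by (simp add: zero_prod_def)
    qed
  qed (fact fin fin' q q')+
  have "flip.related v u \<longleftrightarrow> related u v" for u
  proof -
    have "(\<forall>w\<in>fiber_product q' q. Q w) \<longleftrightarrow> (\<forall>w\<in>C. Q (prod.swap w))" for Q
      using sw by (metis swap_swap)
    moreover have "a + b = c \<longleftrightarrow> c - b = a" for a b c :: real
      by auto
    ultimately show ?thesis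
      using sw[of "(fst v, fst u)"] by (simp add: related_def flip.related_def)
  qed
  then show ?thesis
    using flip.related_left_total[of v] flip.related_right_unique[of v] by auto
qed

end

section \<open>The isomorphism whose graph is the relation\<close>

theorem theorem3p8:
  fixes brg :: "'g::real_vector \<Rightarrow> 'g \<Rightarrow> 'g"
    and brv :: "'h::real_vector \<Rightarrow> 'h \<Rightarrow> 'h"
    and brn :: "'n::real_vector \<Rightarrow> 'n \<Rightarrow> 'n"
    and H :: "'g \<Rightarrow> 'g \<Rightarrow> 'g \<Rightarrow> real"
    and Hv :: "'h \<Rightarrow> 'h \<Rightarrow> 'h \<Rightarrow> real"
  assumes "lie_algebra brg" and "lie_algebra brv" and "lie_algebra brn"
    and "closed_three_form brg H" and "closed_three_form brv Hv"
    and "\<exists>a av. admissible brg a H \<and> admissible brv av Hv \<and>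
           dual_triples brn brg a H brv av Hv"
  shows "\<exists>\<phi> :: 'g \<times> 'g dual \<Rightarrow> 'h \<times> 'h dual.
           linear \<phi> \<and> bij \<phi> \<and>
           (\<forall>u v. \<phi> (courant_bracket brg H u v) = courant_bracket brv Hv (\<phi> u) (\<phi> v)) \<and>
           (\<forall>u v. dual_pairing (\<phi> u) (\<phi> v) = dual_pairing u v)"
proof -
  \<comment> \<open>The ideals are rewritten as the kernels of the quotient maps, the form in which
    the locale expects them.\<close>
  obtain q q' F where hom: "lie_hom brg brn q" "surj q" and hom': "lie_hom brv brn q'" "surj q'"
    and F: "two_form_on (fiber_product q q') F"
      "nondegenerate_pairing ({x. q x = 0} \<times> {0}) ({0} \<times> {y. q' y = 0}) F"
    and dF: "\<And>u v w. u \<in> fiber_product q q' \<Longrightarrow> v \<in> fiber_product q q' \<Longrightarrow>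
      w \<in> fiber_product q q' \<Longrightarrow> H (fst u) (fst v) (fst w) - Hv (snd u) (snd v) (snd w)
             = d2 (prod_bracket brg brv) F u v w"
    using assms(6) unfolding dual_triples_def quotient_hom_def by metis
  interpret g: lie_algebra brg by fact
  interpret h: lie_algebra brv by fact
  interpret fiberwise_nondegenerate q q' F
    using g.fin_dim h.fin_dim hom hom' F
    by (simp add: fiberwise_nondegenerate_def lie_hom_def)
  obtain \<phi> where \<phi>: "\<And>u. related u (\<phi> u)"
    using related_left_total by metis
  \<comment> \<open>By uniqueness, linearity and compatibility with the brackets reduce to closure
    of the relation under the corresponding operations.\<close>
  have \<phi>_eq: "\<phi> u = v" if "related u v" for u v
    using related_right_unique[OF \<phi> that] .
  have "linear \<phi>"
    by (intro linearI \<phi>_eq related_add related_scale \<phi>)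
  moreover have "bij \<phi>"
    using related_ex1_left \<phi> \<phi>_eq by (metis bijI')
  moreover have "\<phi> (courant_bracket brg H u v) = courant_bracket brv Hv (\<phi> u) (\<phi> v)" for u v
  proof (intro \<phi>_eq related_courant[where brn = brn] assms(1,2) \<phi>)
    show "three_form_on UNIV H" "three_form_on UNIV Hv"
      using assms(4,5) by (simp_all add: closed_three_form_def)
    show "q (brg x y) = brn (q x) (q y)" for x y
      using hom by (simp add: lie_hom_def)
    show "q' (brv x y) = brn (q' x) (q' y)" for x y
      using hom' by (simp add: lie_hom_def)
  qed (fact dF)
  ultimately show ?thesis
    using related_pairing[OF \<phi> \<phi>] by blast
qed

end
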